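(* Let $0<t<\infty$, $0\le r<s<\infty$, and let $\mu$ be a finite positive Borel measure on $[0,1)$. Then the following conditions are equivalent: (i) $\mu$ is an $s$-Carleson measure on $[0,1)$; (ii) $$\sup_{a\in\mathbb{D}}\int_{[0,1)}\frac{(1-|a|)^t}{(1-x)^r(1-|a|x)^{s+t-r}}\,d\mu(x)<\infty;$$ (iii) $$\sup_{a\in\mathbb{D}}\int_{[0,1)}\frac{(1-|a|)^t}{(1-x)^r|1-ax|^{s+t-r}}\,d\mu(x)<\infty.$$
   Context: $\mathbb{D}$ is the open unit disk in $\mathbb{C}$. For $0<s<\infty$, a positive Borel measure $\mu$ on $[0,1)$ is an $s$-Carleson measure if there is a constant $C>0$ such that $\mu([x,1))\le C(1-x)^s$ for all $x\in[0,1)$. *)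

theory Defs
  imports "HOL-Analysis.Analysis"
begin

definition borel_measure_on_unit_interval :: "real measure \<Rightarrow> bool" where
  "borel_measure_on_unit_interval M \<longleftrightarrow>
     sets M = sets (restrict_space borel {0..<1})"

definition carleson_measure :: "real \<Rightarrow> real measure \<Rightarrow> bool" where
  "carleson_measure s M \<longleftrightarrow>
     (\<exists>C>0. \<forall>x\<in>{0..<1}. emeasure M {x..<1} \<le> ennreal (C * (1 - x) powr s))"

end

theory Submission
  imports Defs
begin

text \<open>
  With \<open>d = 1 - cmod a\<close>, one has \<open>1 - cmod a * x \<ge> max d (1 - x)\<close>. For (i) to (ii), split the
  interval dyadically according to the size of \<open>(1 - x) / d\<close>: the shells on which \<open>1 - x\<close> is about
  \<open>d / 2 ^ k\<close> contribute \<open>O(2 powr (-k (s - r)))\<close>, those on which it is about \<open>d * 2 ^ k\<close> contribute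
  \<open>O(2 powr (-k t))\<close>, both independently of \<open>d\<close>. For (ii) to (i), test with \<open>a = x\<close>, where the kernel
  is at least a multiple of \<open>(1 - x) powr (-s)\<close> on \<open>{x..<1}\<close>. Finally (ii) and (iii) have the same
  supremum, because \<open>cmod (1 - a x) \<ge> 1 - cmod a * x\<close> with equality when \<open>a = cmod a\<close>.
\<close>

section \<open>Dyadic scales and geometric series\<close>

lemma dyadic_shell:
  fixes z :: real
  assumes "1 \<le> z"
  obtains k :: nat where "2 powr k \<le> z" "z < 2 powr (k + 1)"
proof -
  define k where "k = nat \<lfloor>log 2 z\<rfloor>"
  have "0 \<le> log 2 z" using assms by simp
  then have "real k \<le> log 2 z" "log 2 z < real k + 1"
    unfolding k_def by linarith+
  then have "2 powr k \<le> z" "z < 2 powr (k + 1)"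
    using assms le_log_iff[of 2 z "real k"] log_less_iff[of 2 z "real k + 1"]
    by (simp_all add: add.commute)
  then show thesis by (rule that)
qed

text \<open>Geometric series of ratio \<open>2 powr (- b)\<close>. It is summed for
  \<open>b = s - r\<close> on the near shells and for \<open>b = t\<close> on the far ones; this is
  where \<open>r < s\<close> and \<open>0 < t\<close> give convergence.\<close>

lemma suminf_ennreal_powr_neg:
  fixes b c :: real
  assumes "0 < b" "0 \<le> c"
  shows "(\<Sum>k::nat. ennreal (c * 2 powr (- real k * b))) = ennreal (c / (1 - 2 powr (- b)))"
proof -
  have q: "\<bar>2 powr (- b)\<bar> < (1::real)" using assms by (simp add: powr_less_one)
  have eq: "2 powr (- real k * b) = (2 powr (- b)) ^ k" for k
    by (simp add: powr_power mult.commute)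
  have "(\<lambda>k. c * 2 powr (- real k * b)) sums (c * (1 / (1 - 2 powr (- b))))"
    unfolding eq using q by (intro sums_mult geometric_sums) simp
  then show ?thesis
    using assms by (intro suminf_ennreal_eq) simp_all
qed

section \<open>Pointwise bounds for the kernel, with \<open>p\<close> in the role of
  \<open>cmod a\<close>\<close>

definition carleson_kernel :: "real \<Rightarrow> real \<Rightarrow> real \<Rightarrow> real \<Rightarrow> real \<Rightarrow> real" where
  "carleson_kernel t r s p x =
     (1 - p) powr t / ((1 - x) powr r * (1 - p * x) powr (s + t - r))"

text \<open>Since x < 1, 1 - p x >= 1 - p, and both exponents in the denominator are nonnegative.
  The bound is meant for 1 - x <= 1 - p, where 1 - p x is comparable to 1 - p.\<close>

lemma carleson_kernel_le_near:
  fixes t r s p x u :: real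
  assumes "0 < t" "0 \<le> r" "r < s" "0 \<le> p" "p < 1" "0 \<le> x" "0 < u" "u \<le> 1 - x"
  shows "carleson_kernel t r s p x \<le> u powr (- r) * (1 - p) powr (r - s)"
proof -
  have "p * x \<le> p" using assms by (intro mult_left_le) auto
  then have px: "p * x < 1" using assms by simp
  have "(1 - p) powr (s + t - r) \<le> (1 - p * x) powr (s + t - r)"
    using assms \<open>p * x \<le> p\<close> by (intro powr_mono2) auto
  moreover have "u powr r \<le> (1 - x) powr r"
    using assms by (intro powr_mono2) auto
  ultimately have "u powr r * (1 - p) powr (s + t - r) \<le>
      (1 - x) powr r * (1 - p * x) powr (s + t - r)"
    by (intro mult_mono) auto
  then have "carleson_kernel t r s p x \<le> (1 - p) powr t / (u powr r * (1 - p) powr (s + t - r))"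
    unfolding carleson_kernel_def using assms px by (intro divide_left_mono mult_pos_pos) auto
  also have "\<dots> = u powr (- r) * (1 - p) powr (r - s)"
    using assms by (simp add: powr_minus_divide powr_diff powr_add field_simps)
  finally show ?thesis .
qed

text \<open>Here 1 - p x >= 1 - x >= u is used for the second factor instead; this is the efficient
  choice when 1 - x exceeds 1 - p.\<close>

lemma carleson_kernel_le_far:
  fixes t r s p x u :: real
  assumes "0 < t" "0 \<le> r" "r < s" "0 \<le> p" "p < 1" "0 \<le> x" "0 < u" "u \<le> 1 - x"
  shows "carleson_kernel t r s p x \<le> (1 - p) powr t * u powr (- s - t)"
proof -
  have px: "p * x \<le> x" using assms by (intro mult_left_le_one_le) auto
  then have "u powr (s + t - r) \<le> (1 - p * x) powr (s + t - r)"
    using assms px by (intro powr_mono2) auto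
  moreover have "u powr r \<le> (1 - x) powr r"
    using assms by (intro powr_mono2) auto
  ultimately have "u powr r * u powr (s + t - r) \<le>
      (1 - x) powr r * (1 - p * x) powr (s + t - r)"
    by (intro mult_mono) auto
  then have "carleson_kernel t r s p x \<le> (1 - p) powr t / (u powr r * u powr (s + t - r))"
    unfolding carleson_kernel_def using assms px by (intro divide_left_mono mult_pos_pos) auto
  also have "\<dots> = (1 - p) powr t * u powr (- s - t)"
    using assms by (simp add: powr_minus_divide powr_diff powr_add field_simps)
  finally show ?thesis .
qed

text \<open>For y >= x one has 1 - x y <= 1 - x^2 <= 2 (1 - x) and 1 - y <= 1 - x. The constant is
  the factor 2 raised to -(s + t - r), and the powers of 1 - x combine to t - r - (s + t - r) =
  -s.\<close>

lemma carleson_kernel_ge_diagonal: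
  fixes t r s x y :: real
  assumes "0 < t" "0 \<le> r" "r < s" "0 \<le> x" "x \<le> y" "y < 1"
  shows "2 powr (r - s - t) * (1 - x) powr (- s) \<le> carleson_kernel t r s x y"
proof -
  have "x * x \<le> x * y" using assms by (intro mult_left_mono) auto
  moreover have "0 \<le> (1 - x) * (1 - x)" by simp
  ultimately have "1 - x * y \<le> 2 * (1 - x)" by (simp add: algebra_simps)
  moreover have "x * y < 1"
    using assms mult_left_le_one_le[of y x] by linarith
  ultimately have "(1 - x * y) powr (s + t - r) \<le> (2 * (1 - x)) powr (s + t - r)"
    using assms by (intro powr_mono2) auto
  moreover have "(1 - y) powr r \<le> (1 - x) powr r"
    using assms by (intro powr_mono2) auto
  ultimately have "(1 - y) powr r * (1 - x * y) powr (s + t - r) \<le>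
      (1 - x) powr r * (2 * (1 - x)) powr (s + t - r)"
    by (intro mult_mono) auto
  then have "(1 - x) powr t / ((1 - x) powr r * (2 * (1 - x)) powr (s + t - r))
      \<le> carleson_kernel t r s x y"
    unfolding carleson_kernel_def using assms \<open>x * y < 1\<close>
    by (intro divide_left_mono mult_pos_pos) auto
  also have "(1 - x) powr t / ((1 - x) powr r * (2 * (1 - x)) powr (s + t - r)) =
      2 powr (r - s - t) * (1 - x) powr (- s)"
    using assms unfolding powr_mult by (simp add: powr_minus_divide powr_diff powr_add field_simps)
  finally show ?thesis .
qed

text \<open>The term of the one shell containing \<open>x\<close> already dominates the kernel; all
  other terms are nonnegative. The indicators are those of whole tails rather than shells, so that
  the Carleson condition applies to them directly. Each weight uses the lower edge of its shell for
  1 - x, each tail the upper edge.\<close>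

lemma carleson_kernel_le_dyadic_sum:
  fixes t r s p x :: real
  assumes trs: "0 < t" "0 \<le> r" "r < s" and p: "0 \<le> p" "p < 1" and x: "0 \<le> x" "x < 1"
  defines "d \<equiv> 1 - p"
  shows "ennreal (carleson_kernel t r s p x) \<le>
     (\<Sum>k::nat. ennreal ((d * 2 powr (- real k - 1)) powr (- r) * d powr (r - s)) *
        indicator {max 0 (1 - d * 2 powr (- real k))..<1} x) +
     (\<Sum>k::nat. ennreal (d powr t * (d * 2 powr real k) powr (- s - t)) *
        indicator {max 0 (1 - d * 2 powr (real k + 1))..<1} x)"
    (is "_ \<le> (\<Sum>k. ?A k) + (\<Sum>k. ?B k)")
proof -
  have d: "0 < d" using p by (simp add: d_def)
  have le_sum: "f k \<le> (\<Sum>k. f k)" for f :: "nat \<Rightarrow> ennreal" and k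
    using sum_le_suminf[of f "{k}"] by simp
  show ?thesis
  proof (cases "1 - x \<le> d")
    case True
    then obtain k :: nat where k: "2 powr k \<le> d / (1 - x)" "d / (1 - x) < 2 powr (k + 1)"
      using dyadic_shell[of "d / (1 - x)"] x by auto
    then have "d * 2 powr (- real k - 1) \<le> 1 - x" "1 - x \<le> d * 2 powr (- real k)"
      using x by (simp_all add: powr_minus_divide powr_diff powr_add field_simps)
    then have "ennreal (carleson_kernel t r s p x) \<le> ?A k"
      using carleson_kernel_le_near[of t r s p x "d * 2 powr (- real k - 1)"] trs p x d
      by (auto simp: indicator_def d_def intro!: ennreal_leI)
    also have "\<dots> \<le> (\<Sum>k. ?A k)" by (rule le_sum)
    finally show ?thesis by (simp add: add_increasing2)
  next
    case False
    then obtain k :: nat where k: "2 powr k \<le> (1 - x) / d" "(1 - x) / d < 2 powr (k + 1)"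
      using dyadic_shell[of "(1 - x) / d"] d by auto
    then have "d * 2 powr k \<le> 1 - x" "1 - x \<le> d * 2 powr (real k + 1)"
      using d by (simp_all add: powr_add field_simps)
    then have "ennreal (carleson_kernel t r s p x) \<le> ?B k"
      using carleson_kernel_le_far[of t r s p x "d * 2 powr k"] trs p x d
      by (auto simp: indicator_def d_def intro!: ennreal_leI)
    also have "\<dots> \<le> (\<Sum>k. ?B k)" by (rule le_sum)
    finally show ?thesis by (simp add: add_increasing)
  qed
qed

section \<open>Integrating the kernel bounds against the measure\<close>

context
  fixes M :: "real measure"
  assumes borel: "borel_measure_on_unit_interval M"
begin

lemma space_unit_interval: "space M = {0..<1}"
  using borel sets_eq_imp_space_eq[of M "restrict_space borel {0..<1}"]
  by (simp add: borel_measure_on_unit_interval_def space_restrict_space)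

lemma atLeastLessThan_in_sets: "0 \<le> x \<Longrightarrow> {x..<1} \<in> sets M"
  using borel by (auto simp: borel_measure_on_unit_interval_def sets_restrict_space_iff)

lemma carleson_measure_imp_integral_bounded:
  fixes t r s :: real
  assumes trs: "0 < t" "0 \<le> r" "r < s" and "carleson_measure s M"
  obtains K :: real
  where "\<And>p. 0 \<le> p \<Longrightarrow> p < 1 \<Longrightarrow> (\<integral>\<^sup>+x. ennreal (carleson_kernel t r s p x) \<partial>M) \<le> ennreal K"
proof -
  obtain C where C: "0 < C"
      "\<And>x. 0 \<le> x \<Longrightarrow> x < 1 \<Longrightarrow> emeasure M {x..<1} \<le> ennreal (C * (1 - x) powr s)"
    using assms(4) by (auto simp: carleson_measure_def)
  \<comment> \<open>The far shells lead to \<open>u > 1\<close>, where the tail is all of [0,1); its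
    measure is at most C, hence at most C u^s.\<close>
  have tail: "emeasure M {max 0 (1 - u)..<1} \<le> ennreal (C * u powr s)" if "0 < u" for u
  proof -
    have "emeasure M {max 0 (1 - u)..<1} \<le> ennreal (C * (1 - max 0 (1 - u)) powr s)"
      using that by (intro C(2)) auto
    also have "\<dots> \<le> ennreal (C * u powr s)"
      using that trs C(1) by (intro ennreal_leI mult_left_mono powr_mono2) auto
    finally show ?thesis .
  qed
  define K where "K = C * 2 powr r / (1 - 2 powr (- (s - r))) + C * 2 powr s / (1 - 2 powr (- t))"
  have "(\<integral>\<^sup>+x. ennreal (carleson_kernel t r s p x) \<partial>M) \<le> ennreal K" if p: "0 \<le> p" "p < 1" for p
  proof -
    define d where "d = 1 - p"
    have d: "0 < d" using p by (simp add: d_def)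
    define \<alpha> where "\<alpha> k = (d * 2 powr (- real k - 1)) powr (- r) * d powr (r - s)" for k :: nat
    define \<beta> where "\<beta> k = d powr t * (d * 2 powr real k) powr (- s - t)" for k :: nat
    define S where "S u = {max 0 (1 - u)..<1}" for u :: real
    have S [measurable]: "S u \<in> sets M" for u
      unfolding S_def by (rule atLeastLessThan_in_sets) simp
    have nonneg: "0 \<le> \<alpha> k" "0 \<le> \<beta> k" for k
      unfolding \<alpha>_def \<beta>_def by simp_all
    have A: "ennreal (\<alpha> k) * emeasure M (S (d * 2 powr (- real k))) \<le>
        ennreal (C * 2 powr r * 2 powr (- real k * (s - r)))" for k
    proof -
      have "ennreal (\<alpha> k) * emeasure M (S (d * 2 powr (- real k))) \<le>
          ennreal (\<alpha> k) * ennreal (C * (d * 2 powr (- real k)) powr s)"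
        unfolding S_def using d by (intro mult_left_mono tail) auto
      also have "\<dots> = ennreal (\<alpha> k * (C * (d * 2 powr (- real k)) powr s))"
        using nonneg by (simp add: ennreal_mult')
      \<comment> \<open>The exponents -r, r - s and s of \<open>d\<close> sum to 0, so the bound is
        uniform in \<open>p\<close>. The \<open>- 1\<close> in the lower edge of the shell leaves
        the factor \<open>2 powr r\<close>.\<close>
      also have "\<alpha> k * (C * (d * 2 powr (- real k)) powr s) =
          C * (d powr (- r) * d powr (r - s) * d powr s) *
            (2 powr ((- real k - 1) * (- r)) * 2 powr (- real k * s))"
        unfolding \<alpha>_def using d by (simp add: powr_mult powr_powr)
      also have "\<dots> = C * 2 powr r * 2 powr (- real k * (s - r))"
        using d unfolding powr_add[symmetric] mult.assoc by (simp add: algebra_simps)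
      finally show ?thesis .
    qed
    have B: "ennreal (\<beta> k) * emeasure M (S (d * 2 powr (real k + 1))) \<le>
        ennreal (C * 2 powr s * 2 powr (- real k * t))" for k
    proof -
      have "ennreal (\<beta> k) * emeasure M (S (d * 2 powr (real k + 1))) \<le>
          ennreal (\<beta> k) * ennreal (C * (d * 2 powr (real k + 1)) powr s)"
        unfolding S_def using d by (intro mult_left_mono tail) auto
      also have "\<dots> = ennreal (\<beta> k * (C * (d * 2 powr (real k + 1)) powr s))"
        using nonneg by (simp add: ennreal_mult')
      \<comment> \<open>Again the exponents of \<open>d\<close> cancel: t + (-s - t) + s = 0. The
        \<open>+ 1\<close> in the upper edge leaves \<open>2 powr s\<close>.\<close>
      also have "\<beta> k * (C * (d * 2 powr (real k + 1)) powr s) =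
          C * (d powr t * d powr (- s - t) * d powr s) *
            (2 powr (real k * (- s - t)) * 2 powr ((real k + 1) * s))"
        unfolding \<beta>_def using d by (simp add: powr_mult powr_powr)
      also have "\<dots> = C * 2 powr s * 2 powr (- real k * t)"
        using d unfolding powr_add[symmetric] mult.assoc by (simp add: algebra_simps)
      finally show ?thesis .
    qed
    have "(\<integral>\<^sup>+x. ennreal (carleson_kernel t r s p x) \<partial>M) \<le>
        (\<integral>\<^sup>+x. (\<Sum>k. ennreal (\<alpha> k) * indicator (S (d * 2 powr (- real k))) x) +
             (\<Sum>k. ennreal (\<beta> k) * indicator (S (d * 2 powr (real k + 1))) x) \<partial>M)"
      unfolding \<alpha>_def \<beta>_def S_def d_def
      using trs p by (intro nn_integral_mono carleson_kernel_le_dyadic_sum)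
        (auto simp: space_unit_interval)
    also have "\<dots> = (\<Sum>k. ennreal (\<alpha> k) * emeasure M (S (d * 2 powr (- real k)))) +
        (\<Sum>k. ennreal (\<beta> k) * emeasure M (S (d * 2 powr (real k + 1))))"
      by (simp add: nn_integral_add nn_integral_suminf nn_integral_cmult_indicator)
    also have "\<dots> \<le> (\<Sum>k. ennreal (C * 2 powr r * 2 powr (- real k * (s - r)))) +
        (\<Sum>k. ennreal (C * 2 powr s * 2 powr (- real k * t)))"
      by (intro add_mono suminf_le A B) auto
    also have "\<dots> = ennreal (C * 2 powr r / (1 - 2 powr (- (s - r)))) +
        ennreal (C * 2 powr s / (1 - 2 powr (- t)))"
      using trs C(1) by (subst (1 2) suminf_ennreal_powr_neg) auto
    also have "\<dots> = ennreal K"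
      unfolding K_def using trs C(1)
      by (intro ennreal_plus[symmetric] divide_nonneg_nonneg) (auto simp: powr_less_one less_imp_le)
    finally show ?thesis .
  qed
  then show thesis by (rule that)
qed

lemma integral_bounded_imp_carleson_measure:
  fixes t r s K :: real
  assumes trs: "0 < t" "0 \<le> r" "r < s" and "0 \<le> K"
    and bound: "\<And>p. 0 \<le> p \<Longrightarrow> p < 1 \<Longrightarrow>
      (\<integral>\<^sup>+x. ennreal (carleson_kernel t r s p x) \<partial>M) \<le> ennreal K"
  shows "carleson_measure s M"
proof -
  define D where "D = (2::real) powr (s + t - r)"
  \<comment> \<open>The summand 1 makes the Carleson constant positive even when
    \<open>K = 0\<close>.\<close>
  have "emeasure M {x..<1} \<le> ennreal ((D * K + 1) * (1 - x) powr s)" if x: "0 \<le> x" "x < 1" for x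
  proof -
    define c where "c = 2 powr (r - s - t) * (1 - x) powr (- s)"
    have c: "0 \<le> c" "D * (1 - x) powr s * c = 1"
      unfolding c_def D_def using x by (simp_all add: powr_minus_divide powr_diff powr_add)
    have "ennreal c * emeasure M {x..<1} = (\<integral>\<^sup>+y. ennreal c * indicator {x..<1} y \<partial>M)"
      using x by (simp add: nn_integral_cmult_indicator atLeastLessThan_in_sets)
    also have "\<dots> \<le> (\<integral>\<^sup>+y. ennreal (carleson_kernel t r s x y) \<partial>M)"
      using carleson_kernel_ge_diagonal[OF trs x(1)]
      by (intro nn_integral_mono) (auto simp: c_def indicator_def intro!: ennreal_leI)
    also have "\<dots> \<le> ennreal K" using x by (rule bound)
    finally have le: "ennreal c * emeasure M {x..<1} \<le> ennreal K" .
    \<comment> \<open>Multiplying by the reciprocal \<open>D * (1 - x) powr s\<close> of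
      \<open>c\<close> replaces a division in the extended reals.\<close>
    have "emeasure M {x..<1} = ennreal (D * (1 - x) powr s * c) * emeasure M {x..<1}"
      by (simp add: c)
    also have "\<dots> = ennreal (D * (1 - x) powr s) * (ennreal c * emeasure M {x..<1})"
      using c(1) by (simp add: ennreal_mult'' mult.assoc)
    also have "\<dots> \<le> ennreal (D * (1 - x) powr s) * ennreal K"
      using le by (intro mult_left_mono) auto
    also have "\<dots> = ennreal (D * (1 - x) powr s * K)"
      using \<open>0 \<le> K\<close> by (simp add: ennreal_mult'')
    also have "\<dots> \<le> ennreal ((D * K + 1) * (1 - x) powr s)"
      by (intro ennreal_leI) (simp add: algebra_simps)
    finally show ?thesis .
  qed
  moreover have "0 < D * K + 1"
    using \<open>0 \<le> K\<close> by (simp add: D_def add_nonneg_pos)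
  ultimately show ?thesis
    unfolding carleson_measure_def by (intro exI[of _ "D * K + 1"]) auto
qed

lemma carleson_measure_iff_SUP_integral_finite:
  fixes t r s :: real
  assumes trs: "0 < t" "0 \<le> r" "r < s"
  shows "carleson_measure s M \<longleftrightarrow>
    (SUP a\<in>ball (0::complex) 1. \<integral>\<^sup>+x. ennreal (carleson_kernel t r s (cmod a) x) \<partial>M) < \<infinity>"
    (is "_ \<longleftrightarrow> ?sup < \<infinity>")
proof
  assume "carleson_measure s M"
  then obtain K :: real where K: "\<And>p. 0 \<le> p \<Longrightarrow> p < 1 \<Longrightarrow>
      (\<integral>\<^sup>+x. ennreal (carleson_kernel t r s p x) \<partial>M) \<le> ennreal K"
    using carleson_measure_imp_integral_bounded[OF trs] by blast
  have "?sup \<le> ennreal K"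
    by (intro SUP_least K) auto
  also have "ennreal K < \<infinity>" by simp
  finally show "?sup < \<infinity>" .
next
  assume "?sup < \<infinity>"
  then obtain K where K: "0 \<le> K" "?sup = ennreal K"
    by (cases ?sup) auto
  have "(\<integral>\<^sup>+x. ennreal (carleson_kernel t r s p x) \<partial>M) \<le> ennreal K" if "0 \<le> p" "p < 1" for p
    unfolding K(2)[symmetric]
    \<comment> \<open>The kernel depends on \<open>a\<close> only through its modulus, so the real
      point \<open>p\<close> of the disk suffices.\<close>
    using that by (intro SUP_upper2[of "complex_of_real p"]) auto
  then show "carleson_measure s M"
    using integral_bounded_imp_carleson_measure[OF trs K(1)] by blast
qed

section \<open>Equality of the suprema in (ii) and (iii)\<close>

lemma SUP_integral_carleson_kernel_eq:
  fixes t r s :: real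
  assumes trs: "0 < t" "0 \<le> r" "r < s"
  shows "(SUP a\<in>ball (0::complex) 1. \<integral>\<^sup>+x. ennreal (carleson_kernel t r s (cmod a) x) \<partial>M) =
    (SUP a\<in>ball (0::complex) 1.
       \<integral>\<^sup>+x. ennreal ((1 - cmod a) powr t /
          ((1 - x) powr r * cmod (1 - a * complex_of_real x) powr (s + t - r))) \<partial>M)"
    (is "?L = (SUP a\<in>_. \<integral>\<^sup>+x. ?g a x \<partial>M)")
proof (rule antisym)
  show "?L \<le> (SUP a\<in>ball 0 1. \<integral>\<^sup>+x. ?g a x \<partial>M)"
  proof (rule SUP_least)
    fix a :: complex assume a: "a \<in> ball 0 1"
    \<comment> \<open>Rotating \<open>a\<close> to \<open>cmod a\<close> keeps it in the disk and
      makes 1 - a x a nonnegative real.\<close>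
    have "ennreal (carleson_kernel t r s (cmod a) x) = ?g (complex_of_real (cmod a)) x"
      if "x \<in> space M" for x
    proof -
      have "cmod a * x \<le> 1"
        using a that by (intro mult_le_one) (auto simp: space_unit_interval)
      then have "cmod (1 - complex_of_real (cmod a) * complex_of_real x) = 1 - cmod a * x"
        using norm_of_real[of "1 - cmod a * x", where 'a = complex] by simp
      then show ?thesis by (simp add: carleson_kernel_def)
    qed
    then have "(\<integral>\<^sup>+x. ennreal (carleson_kernel t r s (cmod a) x) \<partial>M) =
        (\<integral>\<^sup>+x. ?g (complex_of_real (cmod a)) x \<partial>M)"
      by (intro nn_integral_cong)
    also have "\<dots> \<le> (SUP a\<in>ball 0 1. \<integral>\<^sup>+x. ?g a x \<partial>M)"
      using a by (intro SUP_upper) auto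
    finally show "(\<integral>\<^sup>+x. ennreal (carleson_kernel t r s (cmod a) x) \<partial>M) \<le>
        (SUP a\<in>ball 0 1. \<integral>\<^sup>+x. ?g a x \<partial>M)" .
  qed
next
  show "(SUP a\<in>ball 0 1. \<integral>\<^sup>+x. ?g a x \<partial>M) \<le> ?L"
  \<comment> \<open>In this direction the same \<open>a\<close> serves on both sides, and the
    integrands compare pointwise.\<close>
  proof (intro SUP_mono bexI nn_integral_mono)
    fix a :: complex and x :: real
    assume a: "a \<in> ball 0 1" and "x \<in> space M"
    then have x: "0 \<le> x" "x < 1" by (auto simp: space_unit_interval)
    have pos: "0 < 1 - cmod a * x"
      using a x mult_left_le[of x "cmod a"] by auto
    have le: "1 - cmod a * x \<le> cmod (1 - a * complex_of_real x)"
      using norm_triangle_ineq2[of 1 "a * complex_of_real x"] x by (simp add: norm_mult)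
    have "(1 - x) powr r * (1 - cmod a * x) powr (s + t - r) \<le>
        (1 - x) powr r * cmod (1 - a * complex_of_real x) powr (s + t - r)"
      using trs pos le by (intro mult_left_mono powr_mono2) auto
    moreover have "0 < (1 - x) powr r * (1 - cmod a * x) powr (s + t - r)"
      using x pos by simp
    ultimately show "?g a x \<le> ennreal (carleson_kernel t r s (cmod a) x)"
      unfolding carleson_kernel_def by (intro ennreal_leI frac_le) auto
  qed
qed

end

theorem proposition2p1:
  fixes t r s :: real and M :: "real measure"
  assumes t: "0 < t" and r: "0 \<le> r" and rs: "r < s"
    and borel: "borel_measure_on_unit_interval M"
    and fin: "finite_measure M"
  defines "cond_i \<equiv> carleson_measure s M"
    and "cond_ii \<equiv>
      (SUP a\<in>ball (0::complex) 1.
         \<integral>\<^sup>+x. ennreal ((1 - cmod a) powr t /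
            ((1 - x) powr r * (1 - cmod a * x) powr (s + t - r))) \<partial>M) < \<infinity>"
    and "cond_iii \<equiv>
      (SUP a\<in>ball (0::complex) 1.
         \<integral>\<^sup>+x. ennreal ((1 - cmod a) powr t /
            ((1 - x) powr r * cmod (1 - a * complex_of_real x) powr (s + t - r))) \<partial>M) < \<infinity>"
  shows "(cond_i \<longleftrightarrow> cond_ii) \<and> (cond_ii \<longleftrightarrow> cond_iii)"
  using carleson_measure_iff_SUP_integral_finite[OF borel t r rs]
    SUP_integral_carleson_kernel_eq[OF borel t r rs]
  unfolding cond_i_def cond_ii_def cond_iii_def carleson_kernel_def by simp

end
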